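(* Let $\gamma\in\mathbb{C}$ and consider the bi-lattice $x(s)=s+\gamma(1+(-1)^s)$. Let $\mathbf{u}\in\mathcal{P}^*$ and suppose that there exists an admissible pair $(\phi,\psi)\in\mathcal{P}_2\times\mathcal{P}_1$ such that $\mathbf{D}_s(\phi\mathbf{u})=\mathbf{S}_s(\psi\mathbf{u})$. Write $\phi(z)=az^2+bz+c$, $\psi(z)=dz+e$, and set $d_n:=an+d$, $e_n:=bn+e$. Then, for each $n=0,1,\ldots$, $$R_n\mathbf{u}=\mathbf{D}_s^n\mathbf{u}^{[n]},$$ where $\mathbf{u}^{[n]}$ is the functional defined recursively in the context and $(R_n)_{n\ge0}$ is the simple set of polynomials given by $$R_{n+1}(z)=(a_nz-s_n)R_n(z)-t_nR_{n-1}(z)\quad(n=0,1,\ldots),\qquad R_{-1}=0,\ R_0=1,$$ with $$a_n:=-\frac{d_{2n}d_{2n-1}}{d_{n-1}},\qquad s_n:=a_n\left(\frac{n\,e_{n-1}}{d_{2n-2}}-\frac{(n+1)e_n}{d_{2n}}\right)\qquad(n\ge0),$$ $$t_n:=a_n\,\frac{n\,d_{2n-2}}{d_{2n-1}}\,\phi^{[n-1]}\left((-1)^s\gamma(1+(-1)^n)-\frac{e_{n-1}}{d_{2n-2}}\right)\qquad(n\ge1),$$ where it is understood that $a_0:=-d$ and $s_0:=e$, and where $$\phi^{[k]}(z)=a\big(z-(-1)^s\gamma(1-(-1)^k)\big)^2+b\big(z-(-1)^s\gamma(1-(-1)^k)\big)+c+k(ak+d)\qquad(k\ge0).$$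
   Context: $\mathcal{P}$ is the space of complex polynomials in $z$, $\mathcal{P}_n$ the polynomials of degree $\le n$, $\mathcal{P}^*$ the algebraic dual of $\mathcal{P}$. A simple set is a sequence $(R_n)_{n\ge0}$ in $\mathcal{P}$ with $\deg R_n=n$. A pair $(\phi,\psi)\in\mathcal{P}_2\times\mathcal{P}_1$ is admissible if $\frac12n\phi''+\psi'\neq0$ for all $n=0,1,\ldots$. Operators on the bi-lattice. For $x(s)=s+\gamma(1+(-1)^s)$ set $$\mathrm{D}_sf(x(s))=\tfrac12\big(f(x(s+1))-f(x(s-1))\big),\qquad \mathrm{S}_sf(x(s))=\tfrac12\big(f(x(s+1))+f(x(s-1))\big).$$ Convention: write $z=x(s)$ and $\varepsilon=(-1)^s$, treated as a sign with $\varepsilon^2=1$. Since $x(s\pm1)=x(s)-2\gamma(-1)^s\pm1$ and $(-1)^{s\pm1}=-(-1)^s$, the operators act on the algebra $\widehat{\mathcal{P}}=E[z]$ of polynomials in $z$ whose coefficients lie in the algebra $E$ of complex functions of $\varepsilon\in\{1,-1\}$, by $$\mathrm{D}_sf(z,\varepsilon)=\tfrac12\big(f(z-2\gamma\varepsilon+1,-\varepsilon)-f(z-2\gamma\varepsilon-1,-\varepsilon)\big),$$ $$\mathrm{S}_sf(z,\varepsilon)=\tfrac12\big(f(z-2\gamma\varepsilon+1,-\varepsilon)+f(z-2\gamma\varepsilon-1,-\varepsilon)\big).$$ Functionals are $\mathbb{C}$-linear maps $\widehat{\mathcal{P}}\to E$; $\mathbf{u}\in\mathcal{P}^*$ is viewed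 as such a map by extending it $E$-linearly. For a functional $\mathbf{v}$ and $f,g\in\widehat{\mathcal{P}}$: $\langle f\mathbf{v},g\rangle=\langle\mathbf{v},fg\rangle$, $\langle\mathbf{D}_s\mathbf{v},f\rangle=-\langle\mathbf{v},\mathrm{D}_sf\rangle$, $\langle\mathbf{S}_s\mathbf{v},f\rangle=\langle\mathbf{v},\mathrm{S}_sf\rangle$. Given $\mathbf{u},\phi,\psi$ define $\phi^{[0]}=\phi$, $\psi^{[0]}=\psi$, $\mathbf{u}^{[0]}=\mathbf{u}$ and, for $k\ge0$, $$\phi^{[k+1]}=\mathrm{S}_s\phi^{[k]}+\mathrm{D}_s\psi^{[k]},\quad \psi^{[k+1]}=\mathrm{D}_s\phi^{[k]}+\mathrm{S}_s\psi^{[k]},\quad \mathbf{u}^{[k+1]}=\mathbf{D}_s(\psi^{[k]}\mathbf{u}^{[k]})-\mathbf{S}_s(\phi^{[k]}\mathbf{u}^{[k]}).$$ (The polynomials $\phi^{[k]}$ have the explicit form displayed in the claim.) *)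

theory Defs
  imports
    Complex_Main
    "HOL-Library.Function_Algebras"
    "HOL-Computational_Algebra.Polynomial"
begin

text \<open>
  The value \<open>(-1)\<^sup>s\<close> is one of two signs.  The algebra \<open>E\<close> of complex functions
  of that sign carries the pointwise ring structure of \<open>Function_Algebras\<close>, and
  the polynomials in \<open>z = x(s)\<close> with coefficients in \<open>E\<close> are the type \<open>E poly\<close>.
\<close>

datatype sign = Plus | Minus

fun opp :: "sign \<Rightarrow> sign" where
  "opp Plus = Minus"
| "opp Minus = Plus"

type_synonym E = "sign \<Rightarrow> complex"

definition eps :: E where
  "eps = (\<lambda>\<sigma>. case \<sigma> of Plus \<Rightarrow> 1 | Minus \<Rightarrow> -1)"

definition const :: "complex \<Rightarrow> E" where
  "const c = (\<lambda>_. c)"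

definition emb :: "complex poly \<Rightarrow> E poly" where
  "emb p = map_poly const p"

text \<open>
  \<open>shift \<gamma> h f\<close> is \<open>f(z - 2\<gamma>\<epsilon> + h, -\<epsilon>)\<close>.  Since
  \<open>x(s \<plusminus> 1) = x(s) - 2\<gamma>(-1)\<^sup>s \<plusminus> 1\<close>, the cases \<open>h = 1\<close> and \<open>h = -1\<close> are
  \<open>f(x(s+1))\<close> and \<open>f(x(s-1))\<close>.  The sign is flipped in the coefficients of \<open>f\<close>
  only, before substituting for \<open>z\<close>; the \<open>\<epsilon>\<close> in the substituted polynomial is not flipped.
\<close>

definition shift :: "complex \<Rightarrow> complex \<Rightarrow> E poly \<Rightarrow> E poly" where
  "shift \<gamma> h f =
     pcompose (map_poly (\<lambda>c. c \<circ> opp) f) [: const h - const (2 * \<gamma>) * eps, 1 :]"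

definition Ds :: "complex \<Rightarrow> E poly \<Rightarrow> E poly" where
  "Ds \<gamma> f = smult (const (1/2)) (shift \<gamma> 1 f - shift \<gamma> (-1) f)"

definition Ss :: "complex \<Rightarrow> E poly \<Rightarrow> E poly" where
  "Ss \<gamma> f = smult (const (1/2)) (shift \<gamma> 1 f + shift \<gamma> (-1) f)"

text \<open>
  Functionals have type \<open>E poly \<Rightarrow> E\<close>.  All of those that occur below are built from an
  extension \<open>ext u\<close> with \<open>u\<close> linear by operations that preserve \<open>\<complex>\<close>-linearity; note
  that \<open>fDs\<close> and \<open>fSs\<close> do not preserve \<open>E\<close>-linearity.
\<close>

type_synonym functional = "E poly \<Rightarrow> E"

definition ext :: "(complex poly \<Rightarrow> complex) \<Rightarrow> functional" where
  "ext u f = (\<Sum>i\<le>degree f. coeff f i * const (u (monom 1 i)))"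

definition lmult :: "E poly \<Rightarrow> functional \<Rightarrow> functional" (infixr "\<odot>" 75) where
  "f \<odot> v = (\<lambda>g. v (f * g))"

definition fDs :: "complex \<Rightarrow> functional \<Rightarrow> functional" where
  "fDs \<gamma> v = (\<lambda>f. - v (Ds \<gamma> f))"

definition fSs :: "complex \<Rightarrow> functional \<Rightarrow> functional" where
  "fSs \<gamma> v = (\<lambda>f. v (Ss \<gamma> f))"

definition admissible :: "complex poly \<Rightarrow> complex poly \<Rightarrow> bool" where
  "admissible \<phi> \<psi> \<longleftrightarrow> degree \<phi> \<le> 2 \<and> degree \<psi> \<le> 1 \<and>
     (\<forall>n::nat. smult (of_nat n / 2) (pderiv (pderiv \<phi>)) + pderiv \<psi> \<noteq> 0)"

definition simple_set :: "(nat \<Rightarrow> complex poly) \<Rightarrow> bool" where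
  "simple_set R \<longleftrightarrow> (\<forall>n. R n \<noteq> 0 \<and> degree (R n) = n)"

fun phi_br :: "complex \<Rightarrow> complex poly \<Rightarrow> complex poly \<Rightarrow> nat \<Rightarrow> E poly"
  and psi_br :: "complex \<Rightarrow> complex poly \<Rightarrow> complex poly \<Rightarrow> nat \<Rightarrow> E poly" where
  "phi_br \<gamma> \<phi> \<psi> 0 = emb \<phi>"
| "phi_br \<gamma> \<phi> \<psi> (Suc k) = Ss \<gamma> (phi_br \<gamma> \<phi> \<psi> k) + Ds \<gamma> (psi_br \<gamma> \<phi> \<psi> k)"
| "psi_br \<gamma> \<phi> \<psi> 0 = emb \<psi>"
| "psi_br \<gamma> \<phi> \<psi> (Suc k) = Ds \<gamma> (phi_br \<gamma> \<phi> \<psi> k) + Ss \<gamma> (psi_br \<gamma> \<phi> \<psi> k)"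

primrec u_br ::
  "complex \<Rightarrow> complex poly \<Rightarrow> complex poly \<Rightarrow> (complex poly \<Rightarrow> complex) \<Rightarrow> nat \<Rightarrow> functional" where
  "u_br \<gamma> \<phi> \<psi> u 0 = ext u"
| "u_br \<gamma> \<phi> \<psi> u (Suc k) =
     fDs \<gamma> (psi_br \<gamma> \<phi> \<psi> k \<odot> u_br \<gamma> \<phi> \<psi> u k) - fSs \<gamma> (phi_br \<gamma> \<phi> \<psi> k \<odot> u_br \<gamma> \<phi> \<psi> u k)"

definition phi_explicit ::
  "complex \<Rightarrow> complex \<Rightarrow> complex \<Rightarrow> complex \<Rightarrow> complex \<Rightarrow> nat \<Rightarrow> E poly" where
  "phi_explicit \<gamma> a b c d k =
     (let w = [: - (eps * const (\<gamma> * (1 - (-1) ^ k))), 1 :]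
      in smult (const a) (w ^ 2) + smult (const b) w
         + [: const (c + of_nat k * (a * of_nat k + d)) :])"

text \<open>
  The indices of \<open>d\<^sub>n = an + d\<close> and \<open>e\<^sub>n = bn + e\<close> are integers, so that \<open>n - 1\<close>
  and \<open>2n - 2\<close> are not truncated; both sequences are \<open>lin_seq\<close>.
\<close>

definition lin_seq :: "complex \<Rightarrow> complex \<Rightarrow> int \<Rightarrow> complex" where
  "lin_seq p q n = p * of_int n + q"

definition rec_a :: "complex \<Rightarrow> complex \<Rightarrow> nat \<Rightarrow> complex" where
  "rec_a a d n =
     (let dd = lin_seq a d; m = int n
      in if n = 0 then - d else - (dd (2*m) * dd (2*m - 1) / dd (m - 1)))"

definition rec_s :: "complex \<Rightarrow> complex \<Rightarrow> complex \<Rightarrow> complex \<Rightarrow> nat \<Rightarrow> complex" where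
  "rec_s a b d e n =
     (let dd = lin_seq a d; ee = lin_seq b e; m = int n
      in if n = 0 then e
         else rec_a a d n *
           (of_nat n * ee (m - 1) / dd (2*m - 2) - (of_nat n + 1) * ee m / dd (2*m)))"

text \<open>Only used for \<open>n \<ge> 1\<close>.  A priori its values depend on the sign.\<close>

definition rec_t :: "complex \<Rightarrow> complex poly \<Rightarrow> complex poly
    \<Rightarrow> complex \<Rightarrow> complex \<Rightarrow> complex \<Rightarrow> complex \<Rightarrow> nat \<Rightarrow> E" where
  "rec_t \<gamma> \<phi> \<psi> a b d e n =
     (let dd = lin_seq a d; ee = lin_seq b e; m = int n
      in const (rec_a a d n * (of_nat n * dd (2*m - 2) / dd (2*m - 1))) *
         poly (phi_br \<gamma> \<phi> \<psi> (n - 1))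
           (eps * const (\<gamma> * (1 + (-1) ^ n)) - const (ee (m - 1) / dd (2*m - 2))))"

fun R :: "complex \<Rightarrow> complex poly \<Rightarrow> complex poly
    \<Rightarrow> complex \<Rightarrow> complex \<Rightarrow> complex \<Rightarrow> complex \<Rightarrow> nat \<Rightarrow> E poly" where
  "R \<gamma> \<phi> \<psi> a b d e 0 = 1"
| "R \<gamma> \<phi> \<psi> a b d e (Suc n) =
     [: - const (rec_s a b d e n), const (rec_a a d n) :] * R \<gamma> \<phi> \<psi> a b d e n
     - (if n = 0 then 0
        else smult (rec_t \<gamma> \<phi> \<psi> a b d e n) (R \<gamma> \<phi> \<psi> a b d e (n - 1)))"

end

theory Submission
  imports Defs
begin

text \<open>
  The two shifts \<open>Q f(x(s)) = f(x(s+1))\<close> and \<open>N f(x(s)) = f(x(s-1))\<close> are mutually inverse ring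
  automorphisms.  With \<open>A\<^sub>k = \<phi>\<^sup>[\<^sup>k\<^sup>] + \<psi>\<^sup>[\<^sup>k\<^sup>]\<close> and \<open>B\<^sub>k = \<phi>\<^sup>[\<^sup>k\<^sup>] - \<psi>\<^sup>[\<^sup>k\<^sup>]\<close> the recursion for the pairs
  becomes \<open>A\<^sub>k\<^sub>+\<^sub>1 = Q A\<^sub>k\<close>, \<open>B\<^sub>k\<^sub>+\<^sub>1 = N B\<^sub>k\<close>, and the functional equation of level \<open>k\<close> says that
  \<open>A\<^sub>k Q p\<close> and \<open>B\<^sub>k N p\<close> have the same image under the \<open>k\<close>-th functional; it is inherited by
  level \<open>k + 1\<close>.  Hence the \<open>n\<close>-fold derivative of the \<open>n\<close>-th functional is the multiple of the
  original one by \<open>L\<^sub>0 L\<^sub>1 \<dots> L\<^sub>n\<^sub>-\<^sub>1 1\<close>, where \<open>L\<^sub>k = (B\<^sub>k N - A\<^sub>k Q) / 2\<close>.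
  For \<open>M\<^sub>k = (B\<^sub>k N + A\<^sub>k Q) / 2\<close> one has \<open>M\<^sub>k L\<^sub>k\<^sub>+\<^sub>1 = L\<^sub>k M\<^sub>k\<^sub>+\<^sub>1\<close>, while \<open>M\<^sub>k\<close> is the commutator of
  \<open>L\<^sub>k\<close> with multiplication by the (twisted) variable.  Moving the variable through
  \<open>L\<^sub>0 \<dots> L\<^sub>n\<^sub>-\<^sub>1\<close> and expanding \<open>\<phi>\<^sup>[\<^sup>n\<^sup>-\<^sup>1\<^sup>]\<close> in the polynomials of degree at most 2 of level \<open>n - 1\<close>
  yields the three-term recurrence.
\<close>

section \<open>Inverse shifts and the polynomials they carry along\<close>

locale shift_chain =
  fixes Q N :: "'a::comm_ring_1 \<Rightarrow> 'a" and \<kappa> :: "complex \<Rightarrow> 'a" and w :: "nat \<Rightarrow> 'a"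
    and a b c d e :: complex
  assumes Q_add: "Q (f + g) = Q f + Q g" and Q_mult: "Q (f * g) = Q f * Q g"
    and N_add: "N (f + g) = N f + N g" and N_mult: "N (f * g) = N f * N g"
    and Q_N [simp]: "Q (N f) = f" and N_Q [simp]: "N (Q f) = f"
    and \<kappa>_add: "\<kappa> (x + y) = \<kappa> x + \<kappa> y" and \<kappa>_mult: "\<kappa> (x * y) = \<kappa> x * \<kappa> y"
    and \<kappa>_1 [simp]: "\<kappa> 1 = 1"
    and Q_\<kappa> [simp]: "Q (\<kappa> x) = \<kappa> x" and N_\<kappa> [simp]: "N (\<kappa> x) = \<kappa> x"
    and Q_w_Suc: "Q (w (Suc k)) = w k + 1" and N_w_Suc: "N (w (Suc k)) = w k - 1"
begin

lemma \<kappa>_0 [simp]: "\<kappa> 0 = 0"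
  using \<kappa>_add[of 0 0] by simp

lemma \<kappa>_minus: "\<kappa> (- x) = - \<kappa> x"
  using \<kappa>_add[of x "- x"] by (simp add: eq_neg_iff_add_eq_0 add.commute)

lemma \<kappa>_diff: "\<kappa> (x - y) = \<kappa> x - \<kappa> y"
  using \<kappa>_add[of x "- y"] by (simp add: \<kappa>_minus)

lemma \<kappa>_of_nat: "\<kappa> (of_nat n) = of_nat n"
  by (induction n) (simp_all add: \<kappa>_add)

lemma \<kappa>_numeral: "\<kappa> (numeral n) = numeral n"
  using \<kappa>_of_nat[of "numeral n"] by simp

lemma Q_1 [simp]: "Q 1 = 1" and N_1 [simp]: "N 1 = 1"
  using Q_\<kappa>[of 1] N_\<kappa>[of 1] by simp_all

lemma Q_of_nat [simp]: "Q (of_nat n) = of_nat n" and N_of_nat [simp]: "N (of_nat n) = of_nat n"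
  using Q_\<kappa>[of "of_nat n"] N_\<kappa>[of "of_nat n"] by (simp_all add: \<kappa>_of_nat)

lemma Q_numeral [simp]: "Q (numeral n) = numeral n" and N_numeral [simp]: "N (numeral n) = numeral n"
  using Q_of_nat[of "numeral n"] N_of_nat[of "numeral n"] by simp_all

lemma Q_diff: "Q (f - g) = Q f - Q g" and N_diff: "N (f - g) = N f - N g"
  using Q_add[of "f - g" g] N_add[of "f - g" g] by simp_all

lemma Q_w: "Q (w k) = w (Suc k) + 1" and N_w: "N (w k) = w (Suc k) - 1"
proof -
  have "Q (w k - 1) = w (Suc k)" using Q_N[of "w (Suc k)"] by (simp only: N_w_Suc)
  then show "Q (w k) = w (Suc k) + 1" by (simp add: Q_diff algebra_simps)
  have "N (w k + 1) = w (Suc k)" using N_Q[of "w (Suc k)"] by (simp only: Q_w_Suc)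
  then show "N (w k) = w (Suc k) - 1" by (simp add: N_add algebra_simps)
qed

lemma \<kappa>_half_double: "\<kappa> (1/2) * f + \<kappa> (1/2) * f = f"
proof -
  have "\<kappa> (1/2) * f + \<kappa> (1/2) * f = \<kappa> (1/2 + 1/2) * f"
    by (simp only: \<kappa>_add distrib_right)
  then show ?thesis by simp
qed

definition \<Delta> :: "'a \<Rightarrow> 'a" where "\<Delta> f = \<kappa> (1/2) * (Q f - N f)"
definition \<Sigma> :: "'a \<Rightarrow> 'a" where "\<Sigma> f = \<kappa> (1/2) * (Q f + N f)"

definition phi :: "nat \<Rightarrow> 'a" where
  "phi k = \<kappa> a * w k ^ 2 + \<kappa> b * w k + \<kappa> (c + of_nat k * (a * of_nat k + d))"
definition psi :: "nat \<Rightarrow> 'a" where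
  "psi k = \<kappa> (d + 2 * a * of_nat k) * w k + \<kappa> (e + b * of_nat k)"

text \<open>As a polynomial in one variable, \<open>A k\<close> is \<phi> + \<psi> at
  \<open>w k + k\<close> and \<open>B k\<close> is \<phi> - \<psi> at \<open>w k - k\<close>.
  \<open>Q\<close> sends the first point to \<open>w (Suc k) + Suc k\<close> and \<open>N\<close>
  sends the second to \<open>w (Suc k) - Suc k\<close>.\<close>

definition A :: "nat \<Rightarrow> 'a" where "A k = phi k + psi k"
definition B :: "nat \<Rightarrow> 'a" where "B k = phi k - psi k"

lemma Q_A: "Q (A k) = A (Suc k)"
  unfolding A_def phi_def psi_def
  by (simp add: Q_add Q_mult Q_w \<kappa>_add \<kappa>_mult \<kappa>_of_nat \<kappa>_numeral power2_eq_square
      algebra_simps)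

lemma N_B: "N (B k) = B (Suc k)"
  unfolding B_def phi_def psi_def
  by (simp add: N_add N_mult N_diff N_w \<kappa>_add \<kappa>_mult \<kappa>_of_nat \<kappa>_numeral power2_eq_square
      algebra_simps)

lemma \<Sigma>_phi_\<Delta>_psi: "\<Sigma> (phi k) + \<Delta> (psi k) = phi (Suc k)"
  and \<Delta>_phi_\<Sigma>_psi: "\<Delta> (phi k) + \<Sigma> (psi k) = psi (Suc k)"
proof -
  have "\<Sigma> (phi k) + \<Delta> (psi k) = \<kappa> (1/2) * (Q (A k) + N (B k))"
    by (simp add: \<Sigma>_def \<Delta>_def A_def B_def Q_add N_diff algebra_simps)
  also have "\<dots> = phi (Suc k)"
    using \<kappa>_half_double[of "phi (Suc k)"] unfolding Q_A N_B by (simp add: A_def B_def algebra_simps)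
  finally show "\<Sigma> (phi k) + \<Delta> (psi k) = phi (Suc k)" .
  have "\<Delta> (phi k) + \<Sigma> (psi k) = \<kappa> (1/2) * (Q (A k) - N (B k))"
    by (simp add: \<Sigma>_def \<Delta>_def A_def B_def Q_add N_diff algebra_simps)
  also have "\<dots> = psi (Suc k)"
    using \<kappa>_half_double[of "psi (Suc k)"] unfolding Q_A N_B by (simp add: A_def B_def algebra_simps)
  finally show "\<Delta> (phi k) + \<Sigma> (psi k) = psi (Suc k)" .
qed

section \<open>Raising operators and their three-term recurrence\<close>

definition L :: "nat \<Rightarrow> 'a \<Rightarrow> 'a" where
  "L k f = \<kappa> (1/2) * (B k * N f - A k * Q f)"
definition M :: "nat \<Rightarrow> 'a \<Rightarrow> 'a" where
  "M k f = \<kappa> (1/2) * (B k * N f + A k * Q f)"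

lemma L_add: "L k (f + g) = L k f + L k g"
  by (simp add: L_def Q_add N_add algebra_simps)

lemma L_\<kappa>: "L k (\<kappa> x * f) = \<kappa> x * L k f"
  by (simp add: L_def Q_mult N_mult algebra_simps)

text \<open>The mixed terms cancel on both sides because \<open>N (A (Suc k)) = A k\<close> and
  \<open>Q (B (Suc k)) = B k\<close>. What remains is a quarter of
  \<open>B k * B (k+2) * N (N f) - A k * A (k+2) * Q (Q f)\<close>.\<close>

lemma M_L_commute: "M k (L (Suc k) f) = L k (M (Suc k) f)"
  unfolding M_def L_def Q_A[symmetric] N_B[symmetric]
  by (simp add: Q_mult N_mult Q_add N_add Q_diff N_diff) (simp add: Q_A N_B algebra_simps)

lemma L_w: "L k (w (Suc k) * f) = w k * L k f - M k f"
  by (simp add: L_def M_def Q_mult N_mult Q_w_Suc N_w_Suc algebra_simps)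

lemma L_1: "L k 1 = - psi k"
  using \<kappa>_half_double[of "psi k"] by (simp add: L_def A_def B_def algebra_simps)

lemma M_1: "M k 1 = phi k"
  using \<kappa>_half_double[of "phi k"] by (simp add: M_def A_def B_def algebra_simps)

primrec raise :: "nat \<Rightarrow> 'a \<Rightarrow> 'a" where
  "raise 0 f = f"
| "raise (Suc n) f = raise n (L n f)"

lemma raise_add: "raise n (f + g) = raise n f + raise n g"
  by (induction n arbitrary: f g) (simp_all add: L_add)

lemma raise_\<kappa>: "raise n (\<kappa> x * f) = \<kappa> x * raise n f"
  by (induction n arbitrary: f) (simp_all add: L_\<kappa>)

lemma raise_minus: "raise n (- f) = - raise n f"
  using raise_\<kappa>[of n "-1" f] by (simp add: \<kappa>_minus)

lemma raise_diff: "raise n (f - g) = raise n f - raise n g"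
  using raise_add[of n f "- g"] by (simp add: raise_minus)

text \<open>Each of the \<open>n + 1\<close> commutators of \<open>w\<close> with a factor \<open>L\<close> contributes an \<open>M\<close>, and
  \<open>M_L_commute\<close> moves all of these to the innermost position, where they coincide.\<close>

lemma raise_w:
  "raise (Suc n) (w (Suc n) * f) = w 0 * raise (Suc n) f - of_nat (Suc n) * raise n (M n f)"
proof (induction n arbitrary: f)
  case 0
  show ?case by (simp add: L_w)
next
  case (Suc n)
  have "raise (Suc (Suc n)) (w (Suc (Suc n)) * f)
      = raise (Suc n) (w (Suc n) * L (Suc n) f) - raise (Suc n) (M (Suc n) f)"
    by (simp add: L_w[of "Suc n"] raise_diff[of "Suc n", simplified] del: raise.simps(1))
  also have "\<dots> = w 0 * raise (Suc (Suc n)) f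
      - of_nat (Suc n) * raise n (M n (L (Suc n) f)) - raise (Suc n) (M (Suc n) f)"
    unfolding Suc by simp
  also have "raise n (M n (L (Suc n) f)) = raise (Suc n) (M (Suc n) f)"
    by (simp add: M_L_commute)
  finally show ?case by (simp add: algebra_simps)
qed

text \<open>\<open>L m 1\<close> and \<open>L m (L (Suc m) 1)\<close> have degrees 1 and 2 in
  \<open>w m\<close>, with leading coefficients \<open>- D\<close> and
  \<open>(D + 2 * a) * (D + a)\<close>, so the expansion is triangular. At the root
  \<open>- E / D\<close> of \<open>psi m\<close> the first vanishes and the second is
  \<open>D + 2 * a\<close> times the value of \<open>phi m\<close>; this gives the constant
  term.\<close>

lemma phi_decomposition:
  fixes m :: nat
  defines "D \<equiv> d + 2 * a * of_nat m" and "E \<equiv> e + b * of_nat m"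
  assumes "D \<noteq> 0" "D + a \<noteq> 0" "D + 2 * a \<noteq> 0"
  shows "phi m = \<kappa> (a / ((D + 2 * a) * (D + a))) * L m (L (Suc m) 1)
    + \<kappa> (E / D - (E + b) / (D + 2 * a)) * L m 1
    + \<kappa> ((a * (E / D)\<^sup>2 - b * (E / D) + c + of_nat m * (a * of_nat m + d)) * D / (D + a))"
proof -
  define K where "K = c + of_nat m * (a * of_nat m + d)"
  define \<alpha> where "\<alpha> = a / ((D + 2 * a) * (D + a))"
  define \<beta> where "\<beta> = E / D - (E + b) / (D + 2 * a)"
  define \<eta> where "\<eta> = (a * (E / D)\<^sup>2 - b * (E / D) + K) * D / (D + a)"
  have psi_m: "psi m = \<kappa> D * w m + \<kappa> E"
    by (simp add: psi_def D_def E_def)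
  have psi_Suc: "psi (Suc m) = \<kappa> (D + 2 * a) * w (Suc m) + \<kappa> (E + b)"
    by (simp add: psi_def D_def E_def algebra_simps)
  have phi_m: "phi m = \<kappa> a * w m ^ 2 + \<kappa> b * w m + \<kappa> K"
    by (simp add: phi_def K_def)
  have L1: "L m 1 = - (\<kappa> D * w m + \<kappa> E)"
    by (simp add: L_1 psi_m)
  have "- psi (Suc m) = \<kappa> (- (D + 2 * a)) * (w (Suc m) * 1) + \<kappa> (- (E + b)) * 1"
    unfolding psi_Suc \<kappa>_minus by (simp add: algebra_simps)
  then have "L m (L (Suc m) 1) = L m (\<kappa> (- (D + 2 * a)) * (w (Suc m) * 1) + \<kappa> (- (E + b)) * 1)"
    by (simp only: L_1)
  also have "\<dots> = \<kappa> (- (D + 2 * a)) * (w m * L m 1 - M m 1) + \<kappa> (- (E + b)) * L m 1"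
    by (simp only: L_add L_\<kappa> L_w)
  also have "\<dots> = \<kappa> ((D + 2 * a) * (D + a)) * w m ^ 2
      + \<kappa> ((D + 2 * a) * (E + b) + (E + b) * D) * w m
      + \<kappa> ((D + 2 * a) * K + (E + b) * E)"
    unfolding L1 M_1 phi_m
    by (simp only: \<kappa>_add \<kappa>_mult \<kappa>_minus) (simp add: power2_eq_square algebra_simps)
  finally have L2: "L m (L (Suc m) 1) = \<dots>" .
  have "\<alpha> * ((D + 2 * a) * (D + a)) = a"
    using assms(3-5) by (simp add: \<alpha>_def)
  moreover have "\<alpha> * ((D + 2 * a) * (E + b) + (E + b) * D) - \<beta> * D = b"
    using assms(3-5) unfolding \<alpha>_def \<beta>_def by (simp add: divide_simps) algebra
  moreover have "\<alpha> * ((D + 2 * a) * K + (E + b) * E) - \<beta> * E + \<eta> = K"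
    using assms(3-5) unfolding \<alpha>_def \<beta>_def \<eta>_def by (simp add: divide_simps) algebra
  ultimately have "phi m = \<kappa> (\<alpha> * ((D + 2 * a) * (D + a))) * w m ^ 2
      + \<kappa> (\<alpha> * ((D + 2 * a) * (E + b) + (E + b) * D) - \<beta> * D) * w m
      + \<kappa> (\<alpha> * ((D + 2 * a) * K + (E + b) * E) - \<beta> * E + \<eta>)"
    by (simp add: phi_m)
  also have "\<dots> = \<kappa> \<alpha> * L m (L (Suc m) 1) + \<kappa> \<beta> * L m 1 + \<kappa> \<eta>"
    unfolding L2 L1 by (simp add: \<kappa>_add \<kappa>_mult \<kappa>_diff algebra_simps)
  finally show ?thesis
    by (simp only: \<alpha>_def \<beta>_def \<eta>_def K_def add.assoc)
qed

lemma raise_three_term: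
  fixes m :: nat
  defines "D \<equiv> d + 2 * a * of_nat m" and "E \<equiv> e + b * of_nat m"
  defines "p \<equiv> - ((D + 2 * a) * (D + a) / (a * of_nat m + d))"
  assumes "D \<noteq> 0" "D + a \<noteq> 0" "D + 2 * a \<noteq> 0" "a * of_nat m + d \<noteq> 0"
  shows "raise (Suc (Suc m)) 1 =
    (\<kappa> p * w 0
      - \<kappa> (p * (of_nat (Suc m) * E / D - (of_nat (Suc m) + 1) * (E + b) / (D + 2 * a))))
      * raise (Suc m) 1
    - \<kappa> (p * (of_nat (Suc m) * D / (D + a))
        * (a * (E / D)\<^sup>2 - b * (E / D) + c + of_nat m * (a * of_nat m + d)))
      * raise m 1"
proof -
  define \<alpha> where "\<alpha> = a / ((D + 2 * a) * (D + a))"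
  define \<beta> where "\<beta> = E / D - (E + b) / (D + 2 * a)"
  define T where "T = a * (E / D)\<^sup>2 - b * (E / D) + c + of_nat m * (a * of_nat m + d)"
  define \<eta> where "\<eta> = T * D / (D + a)"
  define F where "F = D + 2 * a"
  define n :: complex where "n = of_nat (Suc m)"
  let ?P0 = "raise m 1" and ?P1 = "raise (Suc m) 1" and ?P2 = "raise (Suc (Suc m)) 1"
  have "phi m = \<kappa> \<alpha> * L m (L (Suc m) 1) + \<kappa> \<beta> * L m 1 + \<kappa> \<eta> * 1"
    using phi_decomposition[of m] assms(4-6)
    unfolding \<alpha>_def \<beta>_def \<eta>_def T_def D_def E_def by simp
  then have phi: "raise m (phi m) = \<kappa> \<alpha> * ?P2 + \<kappa> \<beta> * ?P1 + \<kappa> \<eta> * ?P0"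
    by (simp only: raise_add raise_\<kappa> raise.simps)
  have "L (Suc m) 1 = \<kappa> (- F) * (w (Suc m) * 1) + \<kappa> (- (E + b)) * 1"
    unfolding \<kappa>_minus by (simp add: L_1 psi_def F_def D_def E_def algebra_simps)
  then have "?P2 = \<kappa> (- F) * raise (Suc m) (w (Suc m) * 1) + \<kappa> (- (E + b)) * ?P1"
    by (metis raise.simps(2) raise_add raise_\<kappa>)
  also have "raise (Suc m) (w (Suc m) * 1) = w 0 * ?P1 - \<kappa> n * raise m (phi m)"
    unfolding raise_w M_1 n_def \<kappa>_of_nat ..
  finally have eq: "?P2 = \<kappa> (- F) * (w 0 * ?P1 - \<kappa> n * (\<kappa> \<alpha> * ?P2 + \<kappa> \<beta> * ?P1 + \<kappa> \<eta> * ?P0))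
      + \<kappa> (- (E + b)) * ?P1"
    unfolding phi .
  \<comment> \<open>The expansion of \<open>phi m\<close> brings \<open>?P2\<close> back on the
    right, so it has to be solved for.\<close>
  have eq': "\<kappa> (1 - F * n * \<alpha>) * ?P2 =
      (\<kappa> (- F) * w 0 + \<kappa> (F * n * \<beta> - (E + b))) * ?P1 + \<kappa> (F * n * \<eta>) * ?P0"
  proof -
    have "(1 - x * y * z) * r = (- x * s + (x * y * t - g)) * q + x * y * h * p"
      if "r = - x * (s * q - y * (z * r + t * q + h * p)) + - g * q" for x y z r s t g q h p :: 'a
    proof -
      have "(1 - x * y * z) * r - ((- x * s + (x * y * t - g)) * q + x * y * h * p)
          = r - (- x * (s * q - y * (z * r + t * q + h * p)) + - g * q)"
        by (simp add: algebra_simps)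
      with that show ?thesis by simp
    qed
    from this[OF eq[unfolded \<kappa>_minus]] show ?thesis
      by (simp only: \<kappa>_add \<kappa>_mult \<kappa>_minus \<kappa>_diff \<kappa>_1)
  qed
  \<comment> \<open>\<open>q\<close> is \<open>(D + a) / (a * of_nat m + d)\<close>, the inverse of
    the factor of \<open>?P2\<close>; it is the source of the denominator of the recurrence
    coefficients.\<close>
  define q where "q = - p / F"
  have "q * (1 - F * n * \<alpha>) = 1"
  proof -
    have "1 - F * n * \<alpha> = (a * of_nat m + d) / (D + a)"
      using assms(4-7) unfolding F_def \<alpha>_def n_def by (simp add: divide_simps D_def) algebra
    then show ?thesis
      using assms(4-7) by (simp add: q_def p_def F_def)
  qed
  then have "?P2 = \<kappa> q * (\<kappa> (1 - F * n * \<alpha>) * ?P2)"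
    by (simp add: mult.assoc[symmetric] \<kappa>_mult[symmetric])
  also have "\<dots> = (\<kappa> (q * - F) * w 0 + \<kappa> (q * (F * n * \<beta> - (E + b)))) * ?P1
      + \<kappa> (q * (F * n * \<eta>)) * ?P0"
    unfolding eq' by (simp only: \<kappa>_mult distrib_left distrib_right mult.assoc)
  also have "q * - F = p"
    using assms(6) unfolding F_def[symmetric] by (simp add: q_def)
  also have "q * (F * n * \<beta> - (E + b)) = - (p * (n * E / D - (n + 1) * (E + b) / F))"
    using assms(4,6) unfolding q_def \<beta>_def F_def by (simp add: divide_simps) algebra
  also have "q * (F * n * \<eta>) = - (p * (n * D / (D + a)) * T)"
    using assms(5,6) unfolding q_def \<eta>_def F_def by (simp add: divide_simps)
  finally show ?thesis
    unfolding n_def F_def T_def by (simp add: \<kappa>_minus)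
qed

end

section \<open>Functionals along the chain\<close>

locale shift_functionals = shift_chain Q N \<kappa> w a b c d e
  for Q N :: "'a::comm_ring_1 \<Rightarrow> 'a" and \<kappa> w a b c d e +
  fixes v :: "nat \<Rightarrow> 'a \<Rightarrow> 'b::ab_group_add"
  assumes v0_add: "v 0 (f + g) = v 0 f + v 0 g"
    and v0_pearson: "- v 0 (phi 0 * \<Delta> f) = v 0 (psi 0 * \<Sigma> f)"
    and v_Suc: "v (Suc k) f = - v k (psi k * \<Delta> f) - v k (phi k * \<Sigma> f)"
begin

lemma \<Delta>_add: "\<Delta> (f + g) = \<Delta> f + \<Delta> g" and \<Sigma>_add: "\<Sigma> (f + g) = \<Sigma> f + \<Sigma> g"
  by (simp_all add: \<Delta>_def \<Sigma>_def Q_add N_add algebra_simps)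

lemma v_add: "v k (f + g) = v k f + v k g"
proof (induction k arbitrary: f g)
  case (Suc k)
  show ?case by (simp add: v_Suc \<Delta>_add \<Sigma>_add distrib_left Suc)
qed (rule v0_add)

lemma v_diff: "v k (f - g) = v k f - v k g"
  using v_add[of k "f - g" g] by simp

lemma v_Suc_AB: "v (Suc k) f = - v k (\<kappa> (1/2) * (A k * Q f)) - v k (\<kappa> (1/2) * (B k * N f))"
proof -
  have "psi k * \<Delta> f + phi k * \<Sigma> f = \<kappa> (1/2) * (A k * Q f) + \<kappa> (1/2) * (B k * N f)"
    by (simp add: \<Delta>_def \<Sigma>_def A_def B_def algebra_simps)
  then show ?thesis
    by (simp only: v_Suc diff_conv_add_uminus minus_add_distrib[symmetric] v_add[symmetric])
qed

text \<open>The next functional is minus the mean of two values that agree. The values lie in a mere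
  abelian group, so the halves stay inside the argument.\<close>

lemma v_Suc_if_pearson:
  assumes "\<And>p. v k (A k * Q p) = v k (B k * N p)"
  shows "v (Suc k) f = - v k (A k * Q f)" "v (Suc k) f = - v k (B k * N f)"
proof -
  have eq: "v k (\<kappa> (1/2) * (A k * Q f)) = v k (\<kappa> (1/2) * (B k * N f))"
    using assms[of "\<kappa> (1/2) * f"] by (simp add: Q_mult N_mult algebra_simps)
  have "v k (A k * Q f) = v k (\<kappa> (1/2) * (A k * Q f)) + v k (\<kappa> (1/2) * (A k * Q f))"
    by (simp only: v_add[symmetric] \<kappa>_half_double)
  then show "v (Suc k) f = - v k (A k * Q f)"
    by (simp add: v_Suc_AB eq)
  then show "v (Suc k) f = - v k (B k * N f)"
    by (simp add: assms)
qed

lemma v_pearson: "v k (A k * Q f) = v k (B k * N f)"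
proof (induction k arbitrary: f)
  case 0
  \<comment> \<open>Doubling absorbs the factor 1/2 in \<open>\<Delta>\<close> and
    \<open>\<Sigma>\<close>.\<close>
  define g where "g = \<kappa> 2 * f"
  have half: "\<kappa> (1/2) * \<kappa> 2 = 1"
    by (simp flip: \<kappa>_mult)
  have g: "\<Delta> g = Q f - N f" "\<Sigma> g = Q f + N f"
    unfolding g_def \<Delta>_def \<Sigma>_def Q_mult N_mult Q_\<kappa> N_\<kappa>
    by (simp_all only: right_diff_distrib[symmetric] distrib_left[symmetric]
        mult.assoc[symmetric] half mult_1_left)
  have "phi 0 * \<Delta> g + psi 0 * \<Sigma> g = A 0 * Q f - B 0 * N f"
    unfolding g by (simp add: A_def B_def algebra_simps)
  moreover have "v 0 (phi 0 * \<Delta> g + psi 0 * \<Sigma> g) = 0"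
    by (simp add: v_add flip: v0_pearson)
  ultimately show ?case
    by (simp add: v_diff)
next
  case (Suc k)
  \<comment> \<open>Each side takes the form of \<open>v (Suc k)\<close> whose shift undoes the one
    present; both become \<open>- v k (A k * B k * f)\<close>.\<close>
  have "v (Suc k) (A (Suc k) * Q f) = - v k (B k * (A k * f))"
    by (subst v_Suc_if_pearson(2)[OF Suc]) (simp add: N_mult flip: Q_A)
  moreover have "v (Suc k) (B (Suc k) * N f) = - v k (A k * (B k * f))"
    by (subst v_Suc_if_pearson(1)[OF Suc]) (simp add: Q_mult flip: N_B)
  ultimately show ?case
    by (simp add: algebra_simps)
qed

lemmas v_Suc_A = v_Suc_if_pearson(1)[OF v_pearson]
  and v_Suc_B = v_Suc_if_pearson(2)[OF v_pearson]

text \<open>Summation by parts: the \<open>B\<close> form for the \<open>Q g\<close> term and the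
  \<open>A\<close> form for the \<open>N g\<close> term free \<open>g\<close> of its shift and move
  it onto \<open>f\<close>.\<close>

lemma v_Suc_\<Delta>: "- v (Suc k) (f * \<Delta> g) = v k (L k f * g)"
proof -
  have "f * \<Delta> g = \<kappa> (1/2) * f * Q g - \<kappa> (1/2) * f * N g"
    by (simp add: \<Delta>_def algebra_simps)
  then have "- v (Suc k) (f * \<Delta> g)
      = - v (Suc k) (\<kappa> (1/2) * f * Q g) + v (Suc k) (\<kappa> (1/2) * f * N g)"
    by (simp add: v_diff)
  also have "\<dots> = v k (B k * (\<kappa> (1/2) * N f * g)) - v k (A k * (\<kappa> (1/2) * Q f * g))"
    by (simp add: v_Suc_B[of k "\<kappa> (1/2) * f * Q g"] v_Suc_A[of k "\<kappa> (1/2) * f * N g"]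
        Q_mult N_mult)
  also have "\<dots> = v k (L k f * g)"
    unfolding v_diff[symmetric] by (simp add: L_def algebra_simps)
  finally show ?thesis .
qed

end

section \<open>The bi-lattice as an instance of the chain\<close>

lemma coeff_map_opp: "coeff (map_poly (\<lambda>c. c \<circ> opp) f) i = coeff f i \<circ> opp"
  for f :: "E poly"
  by (rule coeff_map_poly) (simp add: fun_eq_iff)

lemma map_opp_add:
  "map_poly (\<lambda>c. c \<circ> opp) (f + g) = map_poly (\<lambda>c. c \<circ> opp) f + map_poly (\<lambda>c. c \<circ> opp) g"
  for f g :: "E poly"
  by (rule poly_eqI) (simp add: coeff_map_opp fun_eq_iff)

lemma sum_fun_apply: "(\<Sum>i\<in>I. F i) x = (\<Sum>i\<in>I. F i x)" for F :: "'i \<Rightarrow> 'x \<Rightarrow> complex"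
  by (induction I rule: infinite_finite_induct) simp_all

lemma map_opp_mult:
  "map_poly (\<lambda>c. c \<circ> opp) (f * g) = map_poly (\<lambda>c. c \<circ> opp) f * map_poly (\<lambda>c. c \<circ> opp) g"
  for f g :: "E poly"
  by (rule poly_eqI) (simp add: coeff_map_opp coeff_mult fun_eq_iff sum_fun_apply)

lemma map_opp_pCons: "map_poly (\<lambda>c. c \<circ> opp) (pCons x f) = pCons (x \<circ> opp) (map_poly (\<lambda>c. c \<circ> opp) f)"
  for f :: "E poly"
  by (rule poly_eqI) (simp add: coeff_map_opp coeff_pCons split: nat.split)

lemma map_opp_opp [simp]: "map_poly (\<lambda>c. c \<circ> opp) (map_poly (\<lambda>c. c \<circ> opp) f) = f"
  for f :: "E poly"
proof -
  have "opp (opp x) = x" for x by (cases x) simp_all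
  then show ?thesis by (intro poly_eqI) (simp add: coeff_map_opp fun_eq_iff)
qed

lemma const_comp [simp]: "const x \<circ> h = const x" and one_comp [simp]: "(1 :: E) \<circ> h = 1"
  by (simp_all add: const_def fun_eq_iff)

lemma eps_opp [simp]: "eps \<circ> opp = - eps"
proof
  show "(eps \<circ> opp) x = (- eps) x" for x by (cases x) (simp_all add: eps_def)
qed

lemma comp_arith: "(f + g) \<circ> h = (f \<circ> h) + (g \<circ> h)" "(f - g) \<circ> h = (f \<circ> h) - (g \<circ> h)"
  "(- f) \<circ> h = - (f \<circ> h)" "(f * g) \<circ> h = (f \<circ> h) * (g \<circ> h)" for f g :: E
  by (simp_all add: fun_eq_iff)

lemma const_add: "const (x + y) = const x + const y"
  and const_mult: "const (x * y) = const x * const y"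
  and const_minus: "const (- x) = - const x"
  and const_diff: "const (x - y) = const x - const y"
  and const_0 [simp]: "const 0 = 0" and const_1 [simp]: "const 1 = 1"
  by (simp_all add: const_def fun_eq_iff)

lemma map_opp_pcompose:
  "map_poly (\<lambda>c. c \<circ> opp) (pcompose f g) =
    pcompose (map_poly (\<lambda>c. c \<circ> opp) f) (map_poly (\<lambda>c. c \<circ> opp) g)"
  for f g :: "E poly"
proof (induction f)
  case (pCons x f)
  then show ?case
    by (simp only: pcompose_pCons map_opp_add map_opp_mult map_opp_pCons map_poly_0)
qed simp

lemma shift_add: "shift \<gamma> h (f + g) = shift \<gamma> h f + shift \<gamma> h g"
  by (simp add: shift_def map_opp_add pcompose_add)

lemma shift_mult: "shift \<gamma> h (f * g) = shift \<gamma> h f * shift \<gamma> h g"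
  by (simp add: shift_def map_opp_mult pcompose_mult)

lemma shift_linear:
  "shift \<gamma> h [:x, 1:] = [:(x \<circ> opp) + const h - const (2 * \<gamma>) * eps, 1:]"
  by (simp add: shift_def map_opp_pCons pcompose_pCons algebra_simps)

lemma shift_const: "shift \<gamma> h [:const x:] = [:const x:]"
  by (simp add: shift_def map_opp_pCons)

text \<open>The sign flip of the outer shift turns the inner translation by
  \<open>-2\<gamma>\<epsilon>\<close> into one by \<open>2\<gamma>\<epsilon>\<close>, so the
  translations cancel.\<close>

lemma shift_inverse: "shift \<gamma> h (shift \<gamma> (- h) f) = f"
proof -
  have "pcompose [: const (- h) + const (2 * \<gamma>) * eps, 1:] [: const h - const (2 * \<gamma>) * eps, 1 :]
      = [:0, 1:]"
    by (simp add: pcompose_pCons const_minus)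
  then show ?thesis
    by (simp add: shift_def map_opp_pcompose map_opp_pCons comp_arith
        flip: pcompose_assoc)
qed

text \<open>The \<open>k\<close>-th variable equals \<open>z - \<gamma>\<epsilon> + (-1)\<^sup>k \<gamma>\<epsilon>\<close>.  Both shifts replace \<open>z - \<gamma>\<epsilon>\<close> by itself \<open>\<plusminus> 1\<close>
  and \<open>\<epsilon>\<close> by \<open>-\<epsilon>\<close>, so that they step along this sequence.\<close>

definition lattice_var :: "complex \<Rightarrow> nat \<Rightarrow> E poly" where
  "lattice_var \<gamma> k = [: - (eps * const (\<gamma> * (1 - (-1) ^ k))), 1 :]"

lemma shift_lattice_var:
  "shift \<gamma> h (lattice_var \<gamma> (Suc k)) = lattice_var \<gamma> k + [:const h:]"
proof -
  have "eps * const (\<gamma> * (1 + (- 1) ^ k)) + const h - const (2 * \<gamma>) * eps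
      = const h - eps * const (\<gamma> * (1 - (-1) ^ k))"
    by (simp add: const_def fun_eq_iff algebra_simps)
  then show ?thesis
    unfolding lattice_var_def shift_linear by (simp add: comp_arith)
qed

lemma shift_chain_bilattice:
  "shift_chain (shift \<gamma> 1) (shift \<gamma> (-1)) (\<lambda>x. [:const x:]) (lattice_var \<gamma>)"
  using shift_inverse[of \<gamma> 1] shift_inverse[of \<gamma> "-1"]
  by unfold_locales
    (simp_all add: shift_add shift_mult const_add const_mult shift_const shift_lattice_var
      const_minus one_pCons)

section \<open>Extended functionals and the simple set\<close>

lemma ext_eq_sum: "ext u f = (\<Sum>i\<le>n. coeff f i * const (u (monom 1 i)))" if "degree f \<le> n"
  unfolding ext_def using that
  by (intro sum.mono_neutral_left) (auto simp: coeff_eq_0)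

lemma ext_add: "ext u (f + g) = ext u f + ext u g"
proof -
  define n where "n = max (degree f) (degree g)"
  have "degree (f + g) \<le> n" "degree f \<le> n" "degree g \<le> n"
    by (auto simp: n_def intro: degree_add_le)
  then show ?thesis
    by (simp add: ext_eq_sum[where n = n] sum.distrib distrib_right)
qed

lemma coeff_emb: "coeff (emb p) i = const (coeff p i)"
  unfolding emb_def by (rule coeff_map_poly) simp

lemma emb_pCons: "emb (pCons x p) = pCons (const x) (emb p)"
  by (rule poly_eqI) (simp add: coeff_emb coeff_pCons split: nat.split)

lemma emb_diff: "emb (p - q) = emb p - emb q"
  by (rule poly_eqI) (simp add: coeff_emb const_diff)

lemma emb_smult: "emb (smult x p) = smult (const x) (emb p)"
  by (rule poly_eqI) (simp add: coeff_emb const_mult)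

lemma emb_0 [simp]: "emb 0 = 0"
  by (simp add: emb_def)

lemma emb_1 [simp]: "emb 1 = 1"
  by (simp add: one_pCons emb_pCons)

text \<open>The induction produces complex polynomials, since \<open>E\<close> has zero divisors and
  degrees need not add there.\<close>

lemma simple_set_R:
  assumes a_nz: "\<And>n. rec_a a d n \<noteq> 0"
    and t_const: "\<And>n. n > 0 \<Longrightarrow> rec_t \<gamma> \<phi> \<psi> a b d e n = const (t n)"
  shows "\<exists>P. simple_set P \<and> (\<forall>n. R \<gamma> \<phi> \<psi> a b d e n = emb (P n))"
proof -
  have "\<exists>p. R \<gamma> \<phi> \<psi> a b d e n = emb p \<and> p \<noteq> 0 \<and> degree p = n" for n
  proof (induction n rule: less_induct)
    case (less n)
    show ?case
    proof (cases n)
      case 0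
      then show ?thesis by (intro exI[of _ 1]) simp
    next
      case (Suc m)
      obtain p where p: "R \<gamma> \<phi> \<psi> a b d e m = emb p" "p \<noteq> 0" "degree p = m"
        using less[of m] Suc by auto
      have "m - 1 < n" using Suc by simp
      \<comment> \<open>For \<open>m = 0\<close> the truncated index names \<open>R 0\<close>; the
        conditional in \<open>r\<close> drops that term.\<close>
      from less[OF this] obtain q where
        q: "R \<gamma> \<phi> \<psi> a b d e (m - Suc 0) = emb q" "degree q \<le> m" by auto
      let ?l = "[:- rec_s a b d e m, rec_a a d m:]"
      define r where "r = ?l * p + - (if m = 0 then 0 else smult (t m) q)"
      have "emb (?l * p) = [:- const (rec_s a b d e m), const (rec_a a d m):] * emb p"
        by (simp add: emb_diff emb_smult emb_pCons)
      then have "R \<gamma> \<phi> \<psi> a b d e n = emb r"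
        by (simp add: Suc r_def p q t_const emb_diff emb_smult)
      moreover have "degree (?l * p) = n"
        using p a_nz[of m] Suc by (subst degree_mult_eq) auto
      then have "degree r = n"
        unfolding r_def using q(2) Suc
        by (subst degree_add_eq_left) (auto intro: le_less_trans[OF degree_smult_le])
      ultimately show ?thesis
        using Suc by (intro exI[of _ r]) auto
    qed
  qed
  then obtain P where "\<And>n. R \<gamma> \<phi> \<psi> a b d e n = emb (P n) \<and> P n \<noteq> 0 \<and> degree (P n) = n"
    by metis
  then show ?thesis
    unfolding simple_set_def by blast
qed

theorem theorem2p1:
  fixes \<gamma> a b c d e :: complex
    and u :: "complex poly \<Rightarrow> complex"
    and \<phi> \<psi> :: "complex poly"
  assumes "Vector_Spaces.linear smult (*) u"
    and "admissible \<phi> \<psi>"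
    and "fDs \<gamma> (emb \<phi> \<odot> ext u) = fSs \<gamma> (emb \<psi> \<odot> ext u)"
    and "\<phi> = [:c, b, a:]"
    and "\<psi> = [:e, d:]"
  shows "(\<forall>k. phi_br \<gamma> \<phi> \<psi> k = phi_explicit \<gamma> a b c d k) \<and>
    (\<exists>P. simple_set P \<and> (\<forall>n. R \<gamma> \<phi> \<psi> a b d e n = emb (P n))) \<and>
    (\<forall>n. R \<gamma> \<phi> \<psi> a b d e n \<odot> ext u = (fDs \<gamma> ^^ n) (u_br \<gamma> \<phi> \<psi> u n))"
proof -
  interpret C: shift_chain "shift \<gamma> 1" "shift \<gamma> (-1)" "\<lambda>x. [:const x:]" "lattice_var \<gamma>" a b c d e
    by (rule shift_chain_bilattice)
  have Ds: "Ds \<gamma> f = C.\<Delta> f" and Ss: "Ss \<gamma> f = C.\<Sigma> f" for f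
    by (simp_all add: Ds_def Ss_def C.\<Delta>_def C.\<Sigma>_def)
  have "phi_br \<gamma> \<phi> \<psi> k = C.phi k \<and> psi_br \<gamma> \<phi> \<psi> k = C.psi k" for k
  proof (induction k)
    case 0
    show ?case
      unfolding C.phi_def C.psi_def
      by (simp add: assms(4,5) emb_pCons lattice_var_def power2_eq_square)
  next
    case (Suc k)
    then show ?case
      by (simp add: Ds Ss C.\<Sigma>_phi_\<Delta>_psi C.\<Delta>_phi_\<Sigma>_psi)
  qed
  then have phi: "phi_br \<gamma> \<phi> \<psi> k = C.phi k" and psi: "psi_br \<gamma> \<phi> \<psi> k = C.psi k" for k
    by blast+
  have explicit: "phi_br \<gamma> \<phi> \<psi> k = phi_explicit \<gamma> a b c d k" for k
    unfolding phi C.phi_def by (simp add: phi_explicit_def lattice_var_def)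
  interpret F: shift_functionals "shift \<gamma> 1" "shift \<gamma> (-1)" "\<lambda>x. [:const x:]" "lattice_var \<gamma>"
    a b c d e "u_br \<gamma> \<phi> \<psi> u"
  proof unfold_locales
    fix f g k
    show "u_br \<gamma> \<phi> \<psi> u 0 (f + g) = u_br \<gamma> \<phi> \<psi> u 0 f + u_br \<gamma> \<phi> \<psi> u 0 g"
      by (simp add: ext_add)
    show "- u_br \<gamma> \<phi> \<psi> u 0 (C.phi 0 * C.\<Delta> f) = u_br \<gamma> \<phi> \<psi> u 0 (C.psi 0 * C.\<Sigma> f)"
      using fun_cong[OF assms(3), of f]
      by (simp add: fDs_def fSs_def lmult_def Ds Ss flip: phi psi)
    show "u_br \<gamma> \<phi> \<psi> u (Suc k) f =
        - u_br \<gamma> \<phi> \<psi> u k (C.psi k * C.\<Delta> f) - u_br \<gamma> \<phi> \<psi> u k (C.phi k * C.\<Sigma> f)"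
      by (simp add: fDs_def fSs_def lmult_def Ds Ss phi psi)
  qed
  have step: "fDs \<gamma> (f \<odot> u_br \<gamma> \<phi> \<psi> u (Suc k)) = C.L k f \<odot> u_br \<gamma> \<phi> \<psi> u k" for f k
    unfolding fDs_def lmult_def Ds by (rule ext) (rule F.v_Suc_\<Delta>)
  \<comment> \<open>With an arbitrary left factor \<open>f\<close> the induction closes: each
    derivative replaces \<open>f\<close> by \<open>L k f\<close> and lowers the level by
    one.\<close>
  have "(fDs \<gamma> ^^ n) (f \<odot> u_br \<gamma> \<phi> \<psi> u n) = C.raise n f \<odot> ext u" for n f
    by (induction n arbitrary: f) (simp_all add: funpow_swap1 step del: u_br.simps(2))
  from this[of _ 1] have rodrigues: "(fDs \<gamma> ^^ n) (u_br \<gamma> \<phi> \<psi> u n) = C.raise n 1 \<odot> ext u" for n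
    by (simp add: lmult_def)
  have nz: "a * of_nat n + d \<noteq> 0" for n
  proof -
    have "smult (of_nat n / 2) (pderiv (pderiv \<phi>)) + pderiv \<psi> = [:a * of_nat n + d:]"
      by (simp add: assms(4,5) pderiv_pCons mult.commute)
    moreover have "smult (of_nat n / 2) (pderiv (pderiv \<phi>)) + pderiv \<psi> \<noteq> 0"
      using assms(2) unfolding admissible_def by blast
    ultimately show ?thesis by auto
  qed
  define D E where "D = (\<lambda>m::nat. d + 2 * a * of_nat m)" and "E = (\<lambda>m::nat. e + b * of_nat m)"
  have D_nz: "D m \<noteq> 0" "D m + a \<noteq> 0" "D m + 2 * a \<noteq> 0" for m
    using nz[of "2 * m"] nz[of "2 * m + 1"] nz[of "2 * m + 2"]
    by (simp_all add: D_def algebra_simps)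
  \<comment> \<open>The recurrence index is \<open>n = Suc m\<close>, so \<open>D m\<close> is
    \<open>d\<close> at index 2n-2 and \<open>E m\<close> is \<open>e\<close> at index n-1.\<close>
  have lin: "lin_seq a d (2 * int (Suc m) - 2) = D m" "lin_seq a d (2 * int (Suc m) - 1) = D m + a"
    "lin_seq a d (2 * int (Suc m)) = D m + 2 * a" "lin_seq a d (int (Suc m) - 1) = a * of_nat m + d"
    "lin_seq b e (int (Suc m) - 1) = E m" "lin_seq b e (int (Suc m)) = E m + b" for m
    by (simp_all add: lin_seq_def D_def E_def algebra_simps)
  have rec_a: "rec_a a d (Suc m) = - ((D m + 2 * a) * (D m + a) / (a * of_nat m + d))" for m
    unfolding rec_a_def Let_def lin by simp
  have rec_s: "rec_s a b d e (Suc m) = rec_a a d (Suc m) *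
      (of_nat (Suc m) * E m / D m - (of_nat (Suc m) + 1) * (E m + b) / (D m + 2 * a))" for m
    unfolding rec_s_def Let_def lin by simp
  have rec_t: "rec_t \<gamma> \<phi> \<psi> a b d e (Suc m) =
      const (rec_a a d (Suc m) * (of_nat (Suc m) * D m / (D m + a))
        * (a * (E m / D m)\<^sup>2 - b * (E m / D m) + c + of_nat m * (a * of_nat m + d)))" for m
  proof -
    \<comment> \<open>As 1 + (-1)^(m+1) = 1 - (-1)^m, the point cancels the offset of the
      \<open>m\<close>-th variable and the sign disappears.\<close>
    have "poly (lattice_var \<gamma> m) (eps * const (\<gamma> * (1 + (- 1) ^ Suc m)) - const (E m / D m))
        = - const (E m / D m)"
      by (simp add: lattice_var_def)
    then have "poly (C.phi m) (eps * const (\<gamma> * (1 + (- 1) ^ Suc m)) - const (E m / D m))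
        = const (a * (E m / D m)\<^sup>2 - b * (E m / D m) + c + of_nat m * (a * of_nat m + d))"
      unfolding C.phi_def by (simp add: poly_power const_def fun_eq_iff power2_eq_square)
    then show ?thesis
      unfolding rec_t_def Let_def lin diff_Suc_1 phi by (simp only: const_mult)
  qed
  have linear_factor: "[:- const x, const y:] = [:const y:] * lattice_var \<gamma> 0 - [:const x:]" for x y
    by (simp add: lattice_var_def)
  have smult_eq_mult: "smult (const x) f = [:const x:] * f" for x f
    by simp
  have R_raise: "R \<gamma> \<phi> \<psi> a b d e n = C.raise n 1" for n
  proof (induction n rule: induct_nat_012)
    case 0
    show ?case by simp
  next
    case 1
    \<comment> \<open>The conventions for index 0 amount to \<open>R\<close> at 1 being
      \<open>- psi 0\<close>.\<close>
    show ?case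
      by (simp add: C.L_1 C.psi_def)
        (simp add: lattice_var_def rec_a_def rec_s_def const_minus)
  next
    case (ge2 m)
    have "R \<gamma> \<phi> \<psi> a b d e (Suc (Suc m)) =
        [: - const (rec_s a b d e (Suc m)), const (rec_a a d (Suc m)) :] * C.raise (Suc m) 1
        - smult (rec_t \<gamma> \<phi> \<psi> a b d e (Suc m)) (C.raise m 1)"
      by (simp only: R.simps(2)[of _ _ _ _ _ _ _ "Suc m"] ge2 nat.simps diff_Suc_1 if_False)
    also have "\<dots> = C.raise (Suc (Suc m)) 1"
      unfolding rec_t rec_s linear_factor smult_eq_mult
      by (simp only: rec_a D_def E_def C.raise_three_term[OF D_nz[of m, unfolded D_def] nz])
    finally show ?case .
  qed
  have a_nz: "rec_a a d n \<noteq> 0" for n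
  proof (cases n)
    case 0
    then show ?thesis using nz[of 0] by (simp add: rec_a_def)
  next
    case (Suc m)
    then show ?thesis using D_nz[of m] nz[of m] by (simp add: rec_a)
  qed
  have "rec_t \<gamma> \<phi> \<psi> a b d e n = const (rec_t \<gamma> \<phi> \<psi> a b d e n Plus)" if "n > 0" for n
  proof (cases n)
    case (Suc m)
    show ?thesis unfolding Suc rec_t unfolding const_def ..
  qed (use that in simp)
  with a_nz have "\<exists>P. simple_set P \<and> (\<forall>n. R \<gamma> \<phi> \<psi> a b d e n = emb (P n))"
    by (rule simple_set_R)
  then show ?thesis
    by (simp only: explicit rodrigues R_raise simp_thms)
qed

end
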